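(* Let $p\in\{2,3,5,7,11,13,17,19,23,29,31,41,47,59,71\}$, let $G_p$ be the degree two meromorphic function on $X_0(p)$ that is invariant under $\widetilde{\omega}_p$, has polar divisor $[0]_0+[\infty]_0$, and is normalized so that its lifting to $H$ has expansion $G_p(\tau)=q^{-1}+\sum_{n\ge0}\alpha^p_nq^n$ about $i\infty$. Let $P_p(\tau)=G_p(\tau)+\sum_{m=0}^{p-1}G_p\big(\frac{\tau+m}{p}\big)$, and write $j(\tau)=q^{-1}+744+\sum_{n\ge1}c_nq^n$. Then $$744=\alpha^p_0(p+1)-P_p(\rho)\qquad\text{and}\qquad c_n=\alpha^p_n+p\,\alpha^p_{np}\quad\text{for all } n\ge1.$$
   Context: $H$ is the upper half-plane, $q=e^{2\pi i\tau}$, $j$ is the modular invariant of $SL_2(\mathbb{Z})$, and $\rho=e^{2\pi i/3}$ (so $j(\rho)=0$). $X_0(p)=\Gamma_0(p)\backslash H^*$ is the compact modular curve ($H^*=H\cup\mathbb{Q}\cup\{\infty\}$), with cusps $[0]_0,[\infty]_0$, where $[\tau]_0=\Gamma_0(p)\tau$. $\widetilde{\omega}_p$ is the involution of $X_0(p)$ induced by $\tau\mapsto-1/(p\tau)$. For the listed primes the quotient $X_0(p)/\widetilde{\omega}_p$ has genus zero, so a function $G_p$ as in the claim exists. *)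

theory Defs
  imports "HOL-Complex_Analysis.Complex_Analysis"
begin

section \<open>The upper half plane and the modular invariant\<close>

definition upper_half_plane :: "complex set" where
  "upper_half_plane = {\<tau>. Im \<tau> > 0}"

definition nome :: "complex \<Rightarrow> complex" where
  "nome \<tau> = exp (2 * of_real pi * \<i> * \<tau>)"

definition rho :: complex where
  "rho = exp (2 * of_real pi * \<i> / 3)"

definition eisenstein_sum :: "nat \<Rightarrow> complex \<Rightarrow> complex" where
  "eisenstein_sum k \<tau> =
     (\<Sum>\<^sub>\<infinity>(m, n) \<in> UNIV - {(0::int, 0::int)}. 1 / (of_int m * \<tau> + of_int n) ^ k)"

definition lattice_g2 :: "complex \<Rightarrow> complex" where
  "lattice_g2 \<tau> = 60 * eisenstein_sum 4 \<tau>"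

definition lattice_g3 :: "complex \<Rightarrow> complex" where
  "lattice_g3 \<tau> = 140 * eisenstein_sum 6 \<tau>"

definition modular_j :: "complex \<Rightarrow> complex" where
  "modular_j \<tau> =
     1728 * lattice_g2 \<tau> ^ 3 / (lattice_g2 \<tau> ^ 3 - 27 * lattice_g3 \<tau> ^ 2)"


section \<open>The modular curve\<close>

definition SL2Z :: "(int^2^2) set" where
  "SL2Z = {A. det A = 1}"

definition Gamma0 :: "nat \<Rightarrow> (int^2^2) set" where
  "Gamma0 p = {A \<in> SL2Z. int p dvd A $ 2 $ 1}"

text \<open>Points of the Riemann sphere are of type \<^typ>\<open>complex option\<close>, with \<^const>\<open>None\<close>
  as the point at infinity.\<close>

definition Hstar :: "complex option set" where
  "Hstar = Some ` (upper_half_plane \<union> \<rat>) \<union> {None}"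

fun moebius :: "int^2^2 \<Rightarrow> complex option \<Rightarrow> complex option" where
  "moebius A None =
     (if A $ 2 $ 1 = 0 then None else Some (of_int (A $ 1 $ 1) / of_int (A $ 2 $ 1)))"
| "moebius A (Some z) =
     (if of_int (A $ 2 $ 1) * z + of_int (A $ 2 $ 2) = 0 then None
      else Some ((of_int (A $ 1 $ 1) * z + of_int (A $ 1 $ 2)) /
                 (of_int (A $ 2 $ 1) * z + of_int (A $ 2 $ 2))))"

definition Gamma0_class :: "nat \<Rightarrow> complex option \<Rightarrow> complex option set" where
  "Gamma0_class p x = (\<lambda>A. moebius A x) ` Gamma0 p"

definition X0 :: "nat \<Rightarrow> complex option set set" where
  "X0 p = Gamma0_class p ` Hstar"

fun fricke :: "nat \<Rightarrow> complex option \<Rightarrow> complex option" where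
  "fricke p None = Some 0"
| "fricke p (Some z) = (if z = 0 then None else Some (- 1 / (of_nat p * z)))"

text \<open>The map \<^term>\<open>fricke p\<close> normalises the action of \<^term>\<open>Gamma0 p\<close>, so the image of a
  class is again a class.\<close>

definition X0_involution :: "nat \<Rightarrow> complex option set \<Rightarrow> complex option set" where
  "X0_involution p x = fricke p ` x"


section \<open>Meromorphic functions on the modular curve\<close>

text \<open>As with \<^const>\<open>nicely_meromorphic_on\<close>, a meromorphic function is complex-valued and
  takes the value 0 at its poles.\<close>

definition lifting :: "nat \<Rightarrow> (complex option set \<Rightarrow> complex) \<Rightarrow> complex \<Rightarrow> complex" where
  "lifting p F \<tau> = F (Gamma0_class p (Some \<tau>))"

text \<open>The width of the cusp \<open>A\<infinity>\<close>: the least \<open>h > 0\<close> such that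
  \<open>A T\<^sup>h A\<^sup>-\<^sup>1\<close> lies in \<^term>\<open>Gamma0 p\<close>, where \<open>T\<close> is the translation by 1. No sign is needed as
  \<open>-1\<close> is in the group.\<close>

definition translation_matrix :: "nat \<Rightarrow> int^2^2" where
  "translation_matrix h = vector [vector [1, int h], vector [0, 1]]"

definition cusp_width :: "nat \<Rightarrow> int^2^2 \<Rightarrow> nat" where
  "cusp_width p A =
     (LEAST h. h > 0 \<and> (\<exists>B \<in> Gamma0 p. B ** A = A ** translation_matrix h))"

text \<open>The local parameter at the cusp \<open>A\<infinity>\<close> of width \<open>h\<close> is \<open>z = exp (2\<pi>i\<tau>/h)\<close> at the class
  of \<open>A\<tau>\<close>. The following is its inverse on the unit disc; by the choice of \<open>h\<close> the branch of
  the logarithm does not matter.\<close>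

definition cusp_chart :: "nat \<Rightarrow> int^2^2 \<Rightarrow> complex \<Rightarrow> complex option set" where
  "cusp_chart p A z = Gamma0_class p (moebius A
     (if z = 0 then None
      else Some (of_nat (cusp_width p A) * Ln z / (2 * of_real pi * \<i>))))"

definition X0_meromorphic :: "nat \<Rightarrow> (complex option set \<Rightarrow> complex) \<Rightarrow> bool" where
  "X0_meromorphic p F \<longleftrightarrow>
     lifting p F nicely_meromorphic_on upper_half_plane \<and>
     (\<forall>A \<in> SL2Z. (F \<circ> cusp_chart p A) nicely_meromorphic_on {0})"

definition pole_order :: "(complex \<Rightarrow> complex) \<Rightarrow> complex \<Rightarrow> nat" where
  "pole_order f z = (if is_pole f z then nat (- zorder f z) else 0)"

text \<open>The ramification index at \<open>\<tau>\<close> of the projection from the upper half plane is the order of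
  the stabiliser of \<open>\<tau>\<close> modulo \<open>\<plusminus>1\<close>.\<close>

definition ramification_index :: "nat \<Rightarrow> complex \<Rightarrow> nat" where
  "ramification_index p \<tau> = card {A \<in> Gamma0 p. moebius A (Some \<tau>) = Some \<tau>} div 2"

text \<open>The order of a pole of \<open>F\<close> at the class of \<open>\<tau>\<close> times the ramification index at \<open>\<tau>\<close> is the
  order of the pole of the lifting at \<open>\<tau>\<close>. Every cusp is of the form \<open>A\<infinity>\<close>.\<close>

definition has_polar_divisor ::
  "nat \<Rightarrow> (complex option set \<Rightarrow> complex) \<Rightarrow> (complex option set \<Rightarrow> nat) \<Rightarrow> bool" where
  "has_polar_divisor p F D \<longleftrightarrow>
     (\<forall>\<tau> \<in> upper_half_plane.
        ramification_index p \<tau> * D (Gamma0_class p (Some \<tau>)) = pole_order (lifting p F) \<tau>) \<and>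
     (\<forall>A \<in> SL2Z. D (Gamma0_class p (moebius A None)) = pole_order (F \<circ> cusp_chart p A) 0)"

definition has_degree :: "nat \<Rightarrow> (complex option set \<Rightarrow> complex) \<Rightarrow> nat \<Rightarrow> bool" where
  "has_degree p F d \<longleftrightarrow>
     (\<exists>D. has_polar_divisor p F D \<and> finite {x \<in> X0 p. D x \<noteq> 0} \<and>
          (\<Sum>x | x \<in> X0 p \<and> D x \<noteq> 0. D x) = d)"

definition point_divisor :: "complex option set \<Rightarrow> complex option set \<Rightarrow> nat" where
  "point_divisor x y = (if y = x then 1 else 0)"

definition trace_function ::
  "nat \<Rightarrow> (complex option set \<Rightarrow> complex) \<Rightarrow> complex \<Rightarrow> complex" where
  "trace_function p F \<tau> =
     lifting p F \<tau> + (\<Sum>m<p. lifting p F ((\<tau> + of_nat m) / of_nat p))"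

end

theory Submission
  imports Defs
begin

text \<open>
  The function \<open>P = trace_function p G\<close> is the trace of \<open>G\<close> from level \<open>p\<close> to level one. Since \<open>G\<close>
  is invariant under \<open>\<tau> \<mapsto> -1/(p\<tau>)\<close>, the summand \<open>G ((\<tau> + m)/p)\<close> equals \<open>G (-1/(\<tau> + m))\<close>, so that
  \<open>P\<close> is the sum of \<open>G\<close> over representatives of the cosets of \<open>\<Gamma>\<^sub>0(p)\<close> in \<open>SL\<^sub>2(\<int>)\<close>: the identity and
  \<open>S T\<^sup>m\<close> for \<open>0 \<le> m < p\<close>. Hence \<open>P\<close> is invariant under \<open>SL\<^sub>2(\<int>)\<close>; this is checked on the two
  generators in \<open>trace_translate\<close> and \<open>trace_inversion\<close>. The polar divisor of \<open>G\<close> is supported at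
  the cusps, so \<open>P\<close> is holomorphic on the upper half plane.

  Summing the expansions of \<open>G\<close> at the points \<open>(\<tau> + m)/p\<close> over \<open>m\<close> kills every power of \<open>q\<^bsup>1/p\<^esup>\<close>
  whose exponent is not divisible by \<open>p\<close>, in particular the polar term, and multiplies the others
  by \<open>p\<close>. This gives (\<open>trace_expansion\<close>)
  \<open>P = q\<^bsup>-1\<^esup> + \<Sum>\<^sub>n (\<alpha>\<^sub>n + p \<alpha>\<^bsub>np\<^esub>) q\<^sup>n\<close>, with the same polar part as \<open>j\<close>.

  So \<open>P - j\<close> is invariant under \<open>SL\<^sub>2(\<int>)\<close> and holomorphic, also at \<open>i\<infinity>\<close>, and is therefore constant
  (\<open>holomorphic_modular_function_constant\<close>). Comparing the coefficients of \<open>q\<^sup>n\<close> gives the formulas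
  for \<open>c\<^sub>n\<close>. The constant is \<open>\<alpha>\<^sub>0 (p + 1) - 744\<close> by the expansion, and it is \<open>P(\<rho>)\<close> because
  \<open>j(\<rho>) = 0\<close>.
\<close>


section \<open>Holomorphic modular functions of level one\<close>

lemma nome_in_ball: "\<tau> \<in> upper_half_plane \<Longrightarrow> nome \<tau> \<in> ball 0 1 - {0}"
  by (simp add: upper_half_plane_def nome_def)

lemma norm_nome: "norm (nome \<tau>) = exp (- 2 * pi * Im \<tau>)"
  by (simp add: nome_def)

lemma norm_nome_less_1_iff: "norm (nome \<tau>) < 1 \<longleftrightarrow> \<tau> \<in> upper_half_plane"
  by (simp add: norm_nome upper_half_plane_def zero_less_mult_iff del: mult_less_0_iff)

lemma nome_add: "nome (x + y) = nome x * nome y"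
  by (simp add: nome_def ring_distribs exp_add)

lemma nome_of_int [simp]: "nome (of_int n) = 1"
  unfolding nome_def exp_eq_1 by auto

lemma nome_of_nat [simp]: "nome (of_nat n) = 1"
  using nome_of_int[of "int n"] by simp

lemma nome_power: "nome \<tau> ^ n = nome (of_nat n * \<tau>)"
  by (simp add: nome_def exp_of_nat_mult [symmetric] mult_ac)

lemma nome_nonzero [simp]: "nome \<tau> \<noteq> 0"
  by (simp add: nome_def)

lemma nome_eq_imp_translate:
  assumes "nome \<sigma> = nome \<tau>"
  obtains n :: int where "\<sigma> = \<tau> + of_int n"
proof -
  from assms obtain n :: int
    where "2 * of_real pi * \<i> * \<sigma> = 2 * of_real pi * \<i> * \<tau> + of_int (2 * n) * of_real pi * \<i>"
    unfolding nome_def exp_eq by (auto simp: ac_simps)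
  hence "(2 * of_real pi * \<i>) * (\<sigma> - \<tau> - of_int n) = 0"
    by (simp add: algebra_simps)
  hence "\<sigma> - \<tau> - of_int n = 0" by simp
  thus ?thesis by (intro that[of n]) (simp add: algebra_simps)
qed

lemma nome_Ln: "q \<noteq> 0 \<Longrightarrow> nome (Ln q / (2 * of_real pi * \<i>)) = q"
  by (simp add: nome_def)

lemma Ln_in_upper_half_plane:
  assumes "q \<noteq> 0" "norm q < 1"
  shows "Ln q / (2 * of_real pi * \<i>) \<in> upper_half_plane"
  using assms by (simp add: norm_nome_less_1_iff [symmetric] nome_Ln)

lemma periodic_int:
  assumes "\<And>\<tau>. \<tau> \<in> upper_half_plane \<Longrightarrow> F (\<tau> + 1) = F \<tau>" "\<tau> \<in> upper_half_plane"
  shows "F (\<tau> + of_int n) = F \<tau>"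
proof -
  have nat: "F (\<tau> + of_nat k) = F \<tau>" if "\<tau> \<in> upper_half_plane" for k \<tau>
  proof (induction k)
    case (Suc k)
    have "\<tau> + of_nat k \<in> upper_half_plane" using that by (simp add: upper_half_plane_def)
    from assms(1)[OF this] Suc show ?case by (simp add: add_ac)
  qed simp
  show ?thesis
  proof (cases "n \<ge> 0")
    case True
    thus ?thesis using nat[OF assms(2), of "nat n"] by simp
  next
    case False
    have "\<tau> + of_int n \<in> upper_half_plane" using assms by (simp add: upper_half_plane_def)
    from nat[OF this, of "nat (- n)"] False show ?thesis by simp
  qed
qed

text \<open>The descended function is \<open>q \<mapsto> F (log q / 2\<pi>i)\<close>. By periodicity the branch of the logarithm
  does not matter, so the cut of the principal branch can be moved to the positive real axis.\<close>

lemma periodic_holomorphic_descends: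
  assumes hol: "F holomorphic_on upper_half_plane"
    and per: "\<And>\<tau>. \<tau> \<in> upper_half_plane \<Longrightarrow> F (\<tau> + 1) = F \<tau>"
  obtains f where "f holomorphic_on ball 0 1 - {0}"
    "\<And>\<tau>. \<tau> \<in> upper_half_plane \<Longrightarrow> f (nome \<tau>) = F \<tau>"
proof -
  define f where "f q = F (Ln q / (2 * of_real pi * \<i>))" for q
  have eqI: "f q = F \<tau>" if "nome \<tau> = q" "q \<in> ball 0 1 - {0}" for q \<tau>
  proof -
    have "nome (Ln q / (2 * of_real pi * \<i>)) = nome \<tau>"
      using that by (simp add: nome_Ln)
    then obtain n :: int where n: "Ln q / (2 * of_real pi * \<i>) = \<tau> + of_int n"
      by (rule nome_eq_imp_translate)
    have "\<tau> \<in> upper_half_plane"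
      using that by (auto simp: norm_nome_less_1_iff [symmetric])
    thus ?thesis unfolding f_def n using periodic_int[of F] per by blast
  qed
  let ?A = "ball 0 1 - \<real>\<^sub>\<le>\<^sub>0" and ?B = "ball 0 1 - \<real>\<^sub>\<ge>\<^sub>0 :: complex set"
  have "f holomorphic_on ?A"
    unfolding f_def
    by (rule holomorphic_on_compose_gen[OF _ hol, unfolded o_def])
       (auto intro!: holomorphic_intros Ln_in_upper_half_plane)
  moreover have "f holomorphic_on ?B"
  proof -
    let ?g = "\<lambda>q. Ln (- q) / (2 * of_real pi * \<i>) + 1 / 2"
    have mem: "?g q \<in> upper_half_plane" if "q \<in> ?B" for q
    proof -
      have "- q \<noteq> 0" "norm (- q) < 1" using that by auto
      from Ln_in_upper_half_plane[OF this] show ?thesis by (simp add: upper_half_plane_def)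
    qed
    have "(\<lambda>q. F (?g q)) holomorphic_on ?B"
      by (rule holomorphic_on_compose_gen[OF _ hol, unfolded o_def])
         (use mem in \<open>auto intro!: holomorphic_intros
            simp: complex_nonpos_Reals_iff complex_nonneg_Reals_iff\<close>)
    moreover have "F (?g q) = f q" if "q \<in> ?B" for q
    proof (rule eqI[symmetric])
      have "nome (1 / 2) = - 1" by (simp add: nome_def)
      moreover have "- q \<noteq> 0" using that by auto
      ultimately show "nome (?g q) = q" by (simp add: nome_add nome_Ln)
    qed (use that in auto)
    ultimately show ?thesis by (subst holomorphic_cong[OF refl]) auto
  qed
  ultimately have "f holomorphic_on (?A \<union> ?B)"
    by (rule holomorphic_on_Un) (auto intro!: open_Diff)
  moreover have "?A \<union> ?B = ball 0 1 - {0}"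
    by (auto simp: complex_nonpos_Reals_iff complex_nonneg_Reals_iff complex_eq_iff)
  ultimately have "f holomorphic_on ball 0 1 - {0}" by simp
  thus ?thesis using that eqI nome_in_ball by blast
qed

lemma inversion_in_upper_half_plane:
  assumes "\<tau> \<in> upper_half_plane"
  shows "- 1 / \<tau> \<in> upper_half_plane"
  using assms unfolding upper_half_plane_def
  by (auto simp: Im_divide intro!: divide_pos_pos add_nonneg_pos)

text \<open>This replaces the fundamental domain. If \<open>\<bar>Re \<sigma>\<bar> \<le> 1/2\<close> and \<open>Im \<sigma> < 1/2\<close>, then
  \<open>\<bar>\<sigma>\<bar>\<^sup>2 \<le> 1/2\<close>, so \<open>\<sigma> \<mapsto> -1/\<sigma>\<close> at least doubles the imaginary part. Translating and inverting
  therefore reaches \<open>Im \<ge> 1/2\<close> after finitely many steps.\<close>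

lemma reduce_to_large_imaginary_part:
  assumes per: "\<And>\<tau>. \<tau> \<in> upper_half_plane \<Longrightarrow> F (\<tau> + 1) = F \<tau>"
    and inv: "\<And>\<tau>. \<tau> \<in> upper_half_plane \<Longrightarrow> F (- 1 / \<tau>) = F \<tau>"
    and "\<tau> \<in> upper_half_plane"
  obtains \<tau>' where "Im \<tau>' \<ge> 1 / 2" "F \<tau>' = F \<tau>"
proof -
  have "\<exists>\<tau>'. Im \<tau>' \<ge> 1 / 2 \<and> F \<tau>' = F \<tau>" if "Im \<tau> \<ge> (1 / 2) ^ Suc n" for n \<tau>
    using that
  proof (induction n arbitrary: \<tau>)
    case 0
    thus ?case by auto
  next
    case (Suc n)
    show ?case
    proof (cases "Im \<tau> \<ge> 1 / 2")
      case False
      define \<sigma> where "\<sigma> = \<tau> - of_int (round (Re \<tau>))"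
      have pos: "Im \<tau> > 0"
        using Suc.prems by (smt (verit) zero_less_power half_gt_zero_iff)
      have uhp: "\<sigma> \<in> upper_half_plane" "\<tau> \<in> upper_half_plane"
        using pos by (auto simp: \<sigma>_def upper_half_plane_def)
      have F\<sigma>: "F \<sigma> = F \<tau>"
        using periodic_int[of F \<tau> "- round (Re \<tau>)"] per uhp by (simp add: \<sigma>_def)
      have "\<bar>Re \<sigma>\<bar> \<le> 1 / 2"
        using of_int_round_abs_le[of "Re \<tau>"] by (simp add: \<sigma>_def abs_minus_commute)
      hence "(Re \<sigma>)\<^sup>2 \<le> (1 / 2)\<^sup>2" by (subst abs_le_square_iff[symmetric]) simp
      moreover have "(Im \<sigma>)\<^sup>2 \<le> (1 / 2)\<^sup>2"
        using False pos by (intro power_mono) (auto simp: \<sigma>_def)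
      ultimately have le: "(Re \<sigma>)\<^sup>2 + (Im \<sigma>)\<^sup>2 \<le> 1 / 2" by (simp add: power2_eq_square)
      have p: "(Re \<sigma>)\<^sup>2 + (Im \<sigma>)\<^sup>2 > 0"
        using pos by (auto simp: \<sigma>_def intro: add_nonneg_pos)
      have "(1 / 2) ^ Suc n \<le> 2 * Im \<sigma>" using Suc.prems by (simp add: \<sigma>_def)
      also have "\<dots> \<le> Im \<sigma> / ((Re \<sigma>)\<^sup>2 + (Im \<sigma>)\<^sup>2)"
      proof -
        have "2 * Im \<sigma> * ((Re \<sigma>)\<^sup>2 + (Im \<sigma>)\<^sup>2) \<le> 2 * Im \<sigma> * (1 / 2)"
          using le pos by (intro mult_left_mono) (auto simp: \<sigma>_def)
        thus ?thesis using p by (simp add: pos_le_divide_eq)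
      qed
      also have "\<dots> = Im (- 1 / \<sigma>)" by (simp add: Im_divide)
      finally have "\<exists>\<tau>'. Im \<tau>' \<ge> 1 / 2 \<and> F \<tau>' = F (- 1 / \<sigma>)" by (rule Suc.IH)
      thus ?thesis using inv[OF uhp(1)] F\<sigma> by simp
    qed auto
  qed
  moreover obtain n where "(1 / 2 :: real) ^ n < Im \<tau>"
    using real_arch_pow_inv[of "Im \<tau>" "1 / 2"] assms(3) by (auto simp: upper_half_plane_def)
  moreover have "(1 / 2 :: real) ^ Suc n \<le> (1 / 2) ^ n" by simp
  ultimately show ?thesis using that by (meson less_le_trans le_less order.trans)
qed

lemma power_series_zero_imp_coeffs_zero:
  fixes a :: "nat \<Rightarrow> complex"
  assumes "r > 0" "\<And>z. norm z < r \<Longrightarrow> (\<lambda>n. a n * z ^ n) sums 0"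
  shows "a n = 0"
proof (rule ccontr)
  assume "a n \<noteq> 0"
  have 1: "(\<lambda>n. a n * (z - 0) ^ n) sums 0" if "norm (z - 0) < r" for z :: complex
    using assms(2) that by simp
  have "a 0 = 0" using assms(2)[of 0] \<open>r > 0\<close> by simp
  with \<open>a n \<noteq> 0\<close> have n: "n > 0" by (cases n) auto
  obtain s where s: "0 < s" and nz: "\<And>z::complex. z \<in> cball 0 s - {0} \<Longrightarrow> (0::complex) \<noteq> 0"
    using powser_0_nonzero[of r 0 a "\<lambda>_. 0" n] 1 \<open>r > 0\<close> \<open>a n \<noteq> 0\<close> n by blast
  from nz[of "of_real s"] s show False by simp
qed

text \<open>In the variable \<open>q\<close>, the function becomes holomorphic on the whole open unit disc. Every value is
  already taken at a point with \<open>Im \<tau> \<ge> 1/2\<close>, that is on the compact disc \<open>\<bar>q\<bar> \<le> e\<^bsup>-\<pi>\<^esup>\<close>, so the modulus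
  attains its maximum and the maximum modulus principle applies.\<close>

lemma holomorphic_modular_function_constant:
  assumes hol: "F holomorphic_on upper_half_plane"
    and per: "\<And>\<tau>. \<tau> \<in> upper_half_plane \<Longrightarrow> F (\<tau> + 1) = F \<tau>"
    and inv: "\<And>\<tau>. \<tau> \<in> upper_half_plane \<Longrightarrow> F (- 1 / \<tau>) = F \<tau>"
    and exp: "\<And>\<tau>. Im \<tau> > Y \<Longrightarrow> (\<lambda>n. b n * nome \<tau> ^ n) sums F \<tau>"
    and "Y > 0"
  shows "\<tau> \<in> upper_half_plane \<Longrightarrow> F \<tau> = b 0"
    and "n \<ge> 1 \<Longrightarrow> b n = 0"
proof -
  obtain f where f: "f holomorphic_on ball 0 1 - {0}"
    "\<And>\<tau>. \<tau> \<in> upper_half_plane \<Longrightarrow> f (nome \<tau>) = F \<tau>"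
    using periodic_holomorphic_descends[OF hol per] by blast
  define g where "g = f(0 := b 0)"
  have gF: "g (nome \<tau>) = F \<tau>" if "\<tau> \<in> upper_half_plane" for \<tau>
    using f(2)[OF that] by (simp add: g_def)
  have surj: "\<exists>\<tau>. \<tau> \<in> upper_half_plane \<and> nome \<tau> = q" if "q \<in> ball 0 1 - {0}" for q
    using that Ln_in_upper_half_plane[of q] nome_Ln[of q] by auto
  define r where "r = exp (- 2 * pi * Y)"
  have r: "0 < r" "r < 1" using \<open>Y > 0\<close> by (auto simp: r_def)
  have ser: "(\<lambda>n. b n * q ^ n) sums g q" if "q \<in> ball 0 r" for q
  proof (cases "q = 0")
    case False
    with that r have "q \<in> ball 0 1 - {0}" by auto
    then obtain \<tau> where \<tau>: "\<tau> \<in> upper_half_plane" "nome \<tau> = q"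
      using surj by blast
    have "exp (- 2 * pi * Im \<tau>) < exp (- 2 * pi * Y)"
      using that \<tau>(2) norm_nome[of \<tau>] by (simp add: r_def)
    hence "Im \<tau> > Y" by simp
    from exp[OF this] show ?thesis using gF[OF \<tau>(1)] \<tau>(2) by simp
  qed (simp add: g_def)
  have "g holomorphic_on (ball 0 1 - {0}) \<union> ball 0 r"
  proof (rule holomorphic_on_Un)
    show "g holomorphic_on ball 0 1 - {0}"
      using f(1) by (rule holomorphic_transform) (simp add: g_def)
    show "g holomorphic_on ball 0 r"
      by (rule power_series_holomorphic[of _ _ b]) (use ser in auto)
  qed auto
  also have "(ball 0 1 - {0}) \<union> ball 0 r = ball (0::complex) 1" using r by auto
  finally have g_hol: "g holomorphic_on ball 0 1" .
  \<comment> \<open>This is the value of \<open>\<bar>q\<bar>\<close> on the line \<open>Im \<tau> = 1/2\<close>.\<close>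
  define s where "s = exp (- pi)"
  have s: "0 < s" "s < 1" by (auto simp: s_def)
  have "continuous_on (cball 0 s) (\<lambda>q. norm (g q))"
    by (intro continuous_on_norm holomorphic_on_imp_continuous_on holomorphic_on_subset[OF g_hol])
       (use s in auto)
  then obtain q0 where q0: "q0 \<in> cball 0 s" "\<And>q. q \<in> cball 0 s \<Longrightarrow> norm (g q) \<le> norm (g q0)"
    using continuous_attains_sup[of "cball (0::complex) s" "\<lambda>q. norm (g q)"] s by auto
  have max: "norm (g q) \<le> norm (g q0)" if "q \<in> ball 0 1" for q
  proof (cases "q = 0")
    case True
    thus ?thesis using q0(2)[of 0] s by simp
  next
    case False
    with that obtain \<tau> where \<tau>: "\<tau> \<in> upper_half_plane" "nome \<tau> = q" using surj[of q] by auto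
    obtain \<tau>' where \<tau>': "Im \<tau>' \<ge> 1 / 2" "F \<tau>' = F \<tau>"
      using reduce_to_large_imaginary_part[OF per inv \<tau>(1)] by blast
    have "nome \<tau>' \<in> cball 0 s" using \<tau>'(1) by (simp add: s_def norm_nome)
    moreover have "g (nome \<tau>') = g q"
      using \<tau> \<tau>' gF[of \<tau>] gF[of \<tau>'] by (simp add: upper_half_plane_def)
    ultimately show ?thesis using q0(2) by metis
  qed
  have "g constant_on ball 0 1"
    by (rule maximum_modulus_principle[OF g_hol, of "ball 0 1" q0]) (use max q0 s in auto)
  then obtain C where "\<And>q. q \<in> ball 0 1 \<Longrightarrow> g q = C" by (auto simp: constant_on_def)
  moreover have "g 0 = b 0" by (simp add: g_def)
  ultimately have const: "g q = b 0" if "q \<in> ball 0 1" for q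
    using that by (metis centre_in_ball zero_less_one)
  show "F \<tau> = b 0" if "\<tau> \<in> upper_half_plane" for \<tau>
    using gF[OF that] const nome_in_ball[OF that] by auto
  show "b n = 0" if "n \<ge> 1" for n
  proof -
    have "(\<lambda>n. (b(0 := 0)) n * q ^ n) sums 0" if "norm q < r" for q
    proof -
      have "(\<lambda>n. b n * q ^ n - (if n = 0 then b 0 else 0)) sums (b 0 - b 0)"
        using ser[of q] const[of q] that r by (intro sums_diff sums_single) auto
      thus ?thesis by (rule back_subst) (auto intro!: arg_cong2[of _ _ _ _ "(sums)"])
    qed
    from power_series_zero_imp_coeffs_zero[OF r(1) this, of n] that show ?thesis by simp
  qed
qed


section \<open>The modular invariant\<close>

text \<open>A matrix in \<open>SL\<^sub>2(\<int>)\<close> permutes the nonzero lattice points, so this is a reindexing of the sum. A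
  divergent sum is 0 by convention, which reindexing preserves as well; hence the identity holds for
  all \<open>k\<close>.\<close>

lemma eisenstein_sum_moebius:
  fixes a b c d :: int
  assumes det: "a * d - b * c = 1" and nz: "of_int c * \<tau> + of_int d \<noteq> 0"
  shows "eisenstein_sum k ((of_int a * \<tau> + of_int b) / (of_int c * \<tau> + of_int d)) =
           (of_int c * \<tau> + of_int d) ^ k * eisenstein_sum k \<tau>"
proof -
  let ?S = "UNIV - {(0::int, 0::int)}"
  let ?j = "of_int c * \<tau> + of_int d"
  let ?\<sigma> = "(of_int a * \<tau> + of_int b) / ?j"
  define h where "h = (\<lambda>(m::int, n::int). 1 / (of_int m * \<tau> + of_int n) ^ k)"
  define g where "g = (\<lambda>(m, n). (a * m + c * n, b * m + d * n))"
  define g' where "g' = (\<lambda>(x, y). (d * x - c * y, a * y - b * x))"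
  have g'g: "g' (g x) = x" for x
  proof (cases x)
    case (Pair m n)
    have "d * (a * m + c * n) - c * (b * m + d * n) = (a * d - b * c) * m"
      "a * (b * m + d * n) - b * (a * m + c * n) = (a * d - b * c) * n"
      by (simp_all add: algebra_simps)
    thus ?thesis using det Pair by (simp add: g_def g'_def)
  qed
  have gg': "g (g' x) = x" for x
  proof (cases x)
    case (Pair m n)
    have "a * (d * m - c * n) + c * (a * n - b * m) = (a * d - b * c) * m"
      "b * (d * m - c * n) + d * (a * n - b * m) = (a * d - b * c) * n"
      by (simp_all add: algebra_simps)
    thus ?thesis using det Pair by (simp add: g_def g'_def)
  qed
  have zero: "g (0, 0) = (0, 0)" "g' (0, 0) = (0, 0)" by (simp_all add: g_def g'_def)
  have bij: "bij_betw g ?S ?S"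
  proof (rule bij_betw_byWitness[where f' = g'])
    show "g ` ?S \<subseteq> ?S" using g'g zero by (smt (verit) DiffE DiffI image_subsetI insertE insertI1 UNIV_I empty_iff)
    show "g' ` ?S \<subseteq> ?S" using gg' zero by (smt (verit) DiffE DiffI image_subsetI insertE insertI1 UNIV_I empty_iff)
  qed (use g'g gg' in auto)
  have summand: "1 / (of_int m * ?\<sigma> + of_int n) ^ k = ?j ^ k * h (g (m, n))" for m n
  proof -
    have "of_int m * ?\<sigma> + of_int n =
        (of_int (a * m + c * n) * \<tau> + of_int (b * m + d * n)) / ?j"
      using nz by (simp add: field_simps)
    thus ?thesis using nz by (simp add: g_def h_def power_divide)
  qed
  have "eisenstein_sum k ?\<sigma> = (\<Sum>\<^sub>\<infinity>x\<in>?S. ?j ^ k * h (g x))"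
    unfolding eisenstein_sum_def by (rule infsum_cong) (simp only: split_beta summand prod.collapse)
  also have "\<dots> = ?j ^ k * (\<Sum>\<^sub>\<infinity>x\<in>?S. h (g x))"
    by (rule infsum_cmult_right')
  also have "(\<Sum>\<^sub>\<infinity>x\<in>?S. h (g x)) = (\<Sum>\<^sub>\<infinity>x\<in>?S. h x)"
    by (rule infsum_reindex_bij_betw[OF bij])
  finally show ?thesis by (simp add: eisenstein_sum_def h_def)
qed

lemma modular_j_moebius:
  fixes a b c d :: int
  assumes "a * d - b * c = 1" "of_int c * \<tau> + of_int d \<noteq> 0"
  shows "modular_j ((of_int a * \<tau> + of_int b) / (of_int c * \<tau> + of_int d)) = modular_j \<tau>"
proof -
  let ?j = "of_int c * \<tau> + of_int d"
  let ?N = "1728 * lattice_g2 \<tau> ^ 3" and ?D = "lattice_g2 \<tau> ^ 3 - 27 * lattice_g3 \<tau> ^ 2"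
  have "modular_j ((of_int a * \<tau> + of_int b) / ?j) = (?j ^ 12 * ?N) / (?j ^ 12 * ?D)"
    unfolding modular_j_def lattice_g2_def lattice_g3_def eisenstein_sum_moebius[OF assms]
    by (simp add: power_mult_distrib power_mult [symmetric] right_diff_distrib mult_ac)
  thus ?thesis using assms(2) by (simp add: modular_j_def)
qed

lemma
  shows rho_in_upper_half_plane: "rho \<in> upper_half_plane"
    and rho_quadratic: "rho\<^sup>2 + rho + 1 = 0"
proof -
  have rho: "rho = Complex (- 1 / 2) (sqrt 3 / 2)"
    by (simp add: rho_def exp_eq_polar complex_eq_iff cos_120 sin_120 Re_exp Im_exp)
  show "rho \<in> upper_half_plane" by (simp add: rho upper_half_plane_def)
  show "rho\<^sup>2 + rho + 1 = 0" by (simp add: rho complex_eq_iff power2_eq_square)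
qed

text \<open>The order three map \<open>\<tau> \<mapsto> (-\<tau> - 1)/\<tau>\<close> fixes \<open>\<rho>\<close> with automorphy factor \<open>\<rho>\<close>. In weight 4 this
  multiplies the Eisenstein sum by \<open>\<rho>\<^sup>4 = \<rho> \<noteq> 1\<close>, which forces it to vanish.\<close>

lemma modular_j_rho: "modular_j rho = 0"
proof -
  have nz: "rho \<noteq> 0" using rho_in_upper_half_plane by (auto simp: upper_half_plane_def)
  have fixed: "(of_int (- 1) * rho + of_int (- 1)) / (of_int 1 * rho + of_int 0) = rho"
    using nz rho_quadratic by (simp add: field_simps power2_eq_square) algebra
  have "eisenstein_sum 4 rho = rho ^ 4 * eisenstein_sum 4 rho"
    using eisenstein_sum_moebius[of "-1" 0 "-1" 1 rho 4] nz unfolding fixed by simp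
  moreover have "rho ^ 4 = rho"
    using rho_quadratic by algebra
  moreover have "rho \<noteq> 1"
    using rho_in_upper_half_plane by (auto simp: upper_half_plane_def)
  ultimately have "eisenstein_sum 4 rho = 0" by simp
  thus ?thesis by (simp add: modular_j_def lattice_g2_def)
qed

text \<open>A \<open>q\<close>-expansion valid on the entire upper half plane is a power series convergent on the whole unit
  disc, so holomorphy of \<open>j\<close> can be read off from it instead of from the Eisenstein series.\<close>

lemma modular_j_holomorphic:
  assumes "\<And>\<tau>. \<tau> \<in> upper_half_plane \<Longrightarrow>
     (\<lambda>n. c n * nome \<tau> ^ n) sums (modular_j \<tau> - inverse (nome \<tau>))"
  shows "modular_j holomorphic_on upper_half_plane"
proof -
  define J where "J q = (\<Sum>n. c n * q ^ n)" for q
  have "(\<lambda>n. c n * q ^ n) sums J q" if "q \<in> ball 0 1" for q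
  proof (cases "q = 0")
    case False
    with that have "(\<lambda>n. c n * nome (Ln q / (2 * of_real pi * \<i>)) ^ n) sums
        (modular_j (Ln q / (2 * of_real pi * \<i>)) - inverse (nome (Ln q / (2 * of_real pi * \<i>))))"
      by (intro assms Ln_in_upper_half_plane) auto
    with False show ?thesis by (auto simp: nome_Ln J_def sums_iff)
  qed (simp add: J_def)
  hence J: "J holomorphic_on ball 0 1"
    by (intro power_series_holomorphic[of _ _ c]) auto
  have nome: "nome holomorphic_on upper_half_plane"
    unfolding nome_def by (intro holomorphic_intros)
  have "(\<lambda>\<tau>. J (nome \<tau>) + inverse (nome \<tau>)) holomorphic_on upper_half_plane"
    by (intro holomorphic_intros nome holomorphic_on_compose_gen[OF nome J, unfolded o_def])
       (use nome_in_ball in auto)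
  moreover have "J (nome \<tau>) + inverse (nome \<tau>) = modular_j \<tau>" if "\<tau> \<in> upper_half_plane" for \<tau>
    using assms[OF that] by (simp add: J_def sums_iff)
  ultimately show ?thesis by (subst holomorphic_cong[OF refl]) auto
qed


section \<open>Functions on the modular curve\<close>

lemma moebius_in_upper_half_plane:
  fixes a b c d :: int
  assumes "\<tau> \<in> upper_half_plane" "a * d - b * c = 1"
  shows "of_int c * \<tau> + of_int d \<noteq> 0"
    and "(of_int a * \<tau> + of_int b) / (of_int c * \<tau> + of_int d) \<in> upper_half_plane"
proof -
  have det: "of_int a * of_int d - of_int b * of_int c = (1 :: real)"
    using arg_cong[OF assms(2), of real_of_int] by simp
  have "Im ((of_int a * \<tau> + of_int b) * cnj (of_int c * \<tau> + of_int d)) =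
        Im \<tau> * (of_int a * of_int d - of_int b * of_int c)"
    by (simp add: algebra_simps)
  hence *: "Im ((of_int a * \<tau> + of_int b) * cnj (of_int c * \<tau> + of_int d)) = Im \<tau>"
    unfolding det by simp
  show "of_int c * \<tau> + of_int d \<noteq> 0"
  proof
    assume "of_int c * \<tau> + of_int d = 0"
    with * assms(1) show False by (simp only: upper_half_plane_def mem_Collect_eq) simp
  qed
  show "(of_int a * \<tau> + of_int b) / (of_int c * \<tau> + of_int d) \<in> upper_half_plane"
    using * assms(1) by (simp add: upper_half_plane_def Im_complex_div_gt_0)
qed

lemma Gamma0_class_upper_half_plane:
  assumes "\<tau> \<in> upper_half_plane"
  shows "Gamma0_class p (Some \<tau>) =
    {Some ((of_int a * \<tau> + of_int b) / (of_int c * \<tau> + of_int d)) |a b c d.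
       a * d - b * c = 1 \<and> int p dvd c}" (is "_ = ?R")
proof (rule set_eqI, rule iffI)
  fix x assume "x \<in> Gamma0_class p (Some \<tau>)"
  then obtain A where A: "A \<in> Gamma0 p" "x = moebius A (Some \<tau>)"
    by (auto simp: Gamma0_class_def)
  hence "A $ 1 $ 1 * A $ 2 $ 2 - A $ 1 $ 2 * A $ 2 $ 1 = 1" "int p dvd A $ 2 $ 1"
    by (auto simp: Gamma0_def SL2Z_def det_2)
  with A(2) moebius_in_upper_half_plane(1)[OF assms this(1)] show "x \<in> ?R" by auto
next
  fix x assume "x \<in> ?R"
  then obtain a b c d
    where x: "x = Some ((of_int a * \<tau> + of_int b) / (of_int c * \<tau> + of_int d))"
      and abcd: "a * d - b * c = 1" "int p dvd c" by auto
  let ?A = "vector [vector [a, b], vector [c, d]] :: int^2^2"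
  have "?A \<in> Gamma0 p" using abcd by (simp add: Gamma0_def SL2Z_def det_2)
  moreover have "moebius ?A (Some \<tau>) = x"
    using x moebius_in_upper_half_plane(1)[OF assms abcd(1)] by simp
  ultimately show "x \<in> Gamma0_class p (Some \<tau>)"
    unfolding Gamma0_class_def by (metis imageI)
qed

lemma Gamma0_class_moebius:
  assumes \<tau>: "\<tau> \<in> upper_half_plane" and "a * d - b * c = 1" "int p dvd c"
  shows "Gamma0_class p (Some ((of_int a * \<tau> + of_int b) / (of_int c * \<tau> + of_int d))) =
         Gamma0_class p (Some \<tau>)"
proof -
  have sub: "Gamma0_class p (Some ((of_int a * \<tau> + of_int b) / (of_int c * \<tau> + of_int d)))
      \<subseteq> Gamma0_class p (Some \<tau>)"
    if \<tau>: "\<tau> \<in> upper_half_plane" and abcd: "a * d - b * c = 1" "int p dvd c" for a b c d \<tau>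
  proof
    let ?\<sigma> = "(of_int a * \<tau> + of_int b) / (of_int c * \<tau> + of_int d)"
    note \<sigma> = moebius_in_upper_half_plane[OF \<tau> abcd(1)]
    fix x assume "x \<in> Gamma0_class p (Some ?\<sigma>)"
    then obtain a' b' c' d'
      where x: "x = Some ((of_int a' * ?\<sigma> + of_int b') / (of_int c' * ?\<sigma> + of_int d'))"
        and abcd': "a' * d' - b' * c' = 1" "int p dvd c'"
      by (subst (asm) Gamma0_class_upper_half_plane[OF \<sigma>(2)]) blast
    have "(of_int a' * ?\<sigma> + of_int b') / (of_int c' * ?\<sigma> + of_int d') =
       (of_int (a' * a + b' * c) * \<tau> + of_int (a' * b + b' * d)) /
       (of_int (c' * a + d' * c) * \<tau> + of_int (c' * b + d' * d))"
    proof -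
      have "of_int u * ?\<sigma> + of_int v =
        (of_int (u * a + v * c) * \<tau> + of_int (u * b + v * d)) / (of_int c * \<tau> + of_int d)"
        for u v :: int
        using \<sigma>(1) by (simp add: field_simps)
      thus ?thesis using \<sigma>(1) by simp
    qed
    moreover have "(a' * a + b' * c) * (c' * b + d' * d) - (a' * b + b' * d) * (c' * a + d' * c) =
       (a' * d' - b' * c') * (a * d - b * c)" by (simp add: algebra_simps)
    hence "(a' * a + b' * c) * (c' * b + d' * d) - (a' * b + b' * d) * (c' * a + d' * c) = 1"
      using abcd abcd' by simp
    moreover have "int p dvd c' * a + d' * c" using abcd abcd' by simp
    ultimately show "x \<in> Gamma0_class p (Some \<tau>)"
      unfolding x Gamma0_class_upper_half_plane[OF \<tau>] by blast
  qed
  let ?\<sigma> = "(of_int a * \<tau> + of_int b) / (of_int c * \<tau> + of_int d)"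
  note \<sigma> = moebius_in_upper_half_plane[OF \<tau> assms(2)]
  have inv: "d * a - (- b) * (- c) = 1" using assms(2) by (simp add: mult_ac)
  have det: "of_int a * of_int d - of_int b * of_int c = (1 :: complex)"
    using arg_cong[OF assms(2), of of_int] by simp
  have "(of_int d * ?\<sigma> + of_int (- b)) / (of_int (- c) * ?\<sigma> + of_int a) = \<tau>"
  proof -
    have "of_int d * ?\<sigma> + of_int (- b) =
        (of_int a * of_int d - of_int b * of_int c) * \<tau> / (of_int c * \<tau> + of_int d)"
      "of_int (- c) * ?\<sigma> + of_int a =
        (of_int a * of_int d - of_int b * of_int c) / (of_int c * \<tau> + of_int d)"
      using \<sigma>(1) by (simp_all add: field_simps)
    thus ?thesis using \<sigma>(1) unfolding det by simp
  qed
  hence "Gamma0_class p (Some \<tau>) \<subseteq> Gamma0_class p (Some ?\<sigma>)"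
    using sub[OF \<sigma>(2) inv] assms(3) by simp
  with sub[OF assms] show ?thesis by blast
qed

lemma lifting_moebius:
  assumes "\<tau> \<in> upper_half_plane" "a * d - b * c = 1" "int p dvd c"
  shows "lifting p F ((of_int a * \<tau> + of_int b) / (of_int c * \<tau> + of_int d)) = lifting p F \<tau>"
  unfolding lifting_def Gamma0_class_moebius[OF assms] ..

lemma fricke_in_upper_half_plane:
  assumes "\<tau> \<in> upper_half_plane" "p > 0"
  shows "- 1 / (of_nat p * \<tau>) \<in> upper_half_plane"
proof -
  have "of_nat p * \<tau> \<in> upper_half_plane" using assms by (simp add: upper_half_plane_def)
  thus ?thesis by (rule inversion_in_upper_half_plane)
qed

text \<open>Conjugating the matrix with rows \<open>(a, b)\<close> and \<open>(pe, d)\<close> by \<open>\<tau> \<mapsto> -1/(p\<tau>)\<close> gives the one with rows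
  \<open>(d, -e)\<close> and \<open>(-pb, a)\<close>, which again lies in \<open>\<Gamma>\<^sub>0(p)\<close>. This gives one inclusion; the other follows
  because the map is an involution.\<close>

lemma X0_involution_class:
  assumes \<tau>: "\<tau> \<in> upper_half_plane" and "p > 0"
  shows "X0_involution p (Gamma0_class p (Some \<tau>)) = Gamma0_class p (Some (- 1 / (of_nat p * \<tau>)))"
proof -
  have sub: "X0_involution p (Gamma0_class p (Some \<tau>))
      \<subseteq> Gamma0_class p (Some (- 1 / (of_nat p * \<tau>)))"
    if \<tau>: "\<tau> \<in> upper_half_plane" for \<tau>
  proof
    fix x assume "x \<in> X0_involution p (Gamma0_class p (Some \<tau>))"
    then obtain a b c d where
        x: "x = fricke p (Some ((of_int a * \<tau> + of_int b) / (of_int c * \<tau> + of_int d)))"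
      and abcd: "a * d - b * c = 1" "int p dvd c"
      unfolding X0_involution_def Gamma0_class_upper_half_plane[OF \<tau>] by blast
    from abcd(2) obtain e where e: "c = int p * e" by auto
    note \<sigma> = moebius_in_upper_half_plane[OF \<tau> abcd(1)]
    have nz: "of_int a * \<tau> + of_int b \<noteq> 0" using \<sigma>(2) by (auto simp: upper_half_plane_def)
    have \<tau>0: "\<tau> \<noteq> 0" using \<tau> by (auto simp: upper_half_plane_def)
    let ?w = "- 1 / (of_nat p * \<tau>)"
    have "x = Some (- ((of_int c * \<tau> + of_int d) / (of_nat p * (of_int a * \<tau> + of_int b))))"
      using x \<sigma>(1) nz by (simp add: minus_divide_left)
    also have "(of_int c * \<tau> + of_int d) / (of_nat p * (of_int a * \<tau> + of_int b)) =
       - ((of_int d * ?w + of_int (- e)) / (of_int (- int p * b) * ?w + of_int a))"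
    proof -
      have w: "of_int d * ?w + of_int (- e) = - (of_int c * \<tau> + of_int d) / (of_nat p * \<tau>)"
        "of_int (- int p * b) * ?w + of_int a = (of_int a * \<tau> + of_int b) / \<tau>"
        using \<tau>0 \<open>p > 0\<close> by (simp_all add: e field_simps)
      show ?thesis unfolding w using \<tau>0 nz \<open>p > 0\<close> by (simp add: divide_simps)
    qed
    finally have "x = Some ((of_int d * ?w + of_int (- e)) / (of_int (- int p * b) * ?w + of_int a))"
      by simp
    moreover have "d * a - (- e) * (- int p * b) = 1"
      using abcd(1) by (simp add: e algebra_simps)
    moreover have "int p dvd - int p * b" by simp
    ultimately show "x \<in> Gamma0_class p (Some ?w)"
      unfolding Gamma0_class_upper_half_plane[OF fricke_in_upper_half_plane[OF \<tau> \<open>p > 0\<close>]] by blast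
  qed
  have "\<tau> \<noteq> 0" using \<tau> by (auto simp: upper_half_plane_def)
  let ?w = "- 1 / (of_nat p * \<tau>)"
  have ww: "- 1 / (of_nat p * ?w) = \<tau>" using \<open>\<tau> \<noteq> 0\<close> \<open>p > 0\<close> by (simp add: field_simps)
  have "Gamma0_class p (Some ?w) \<subseteq> X0_involution p (Gamma0_class p (Some \<tau>))"
  proof
    fix x assume x: "x \<in> Gamma0_class p (Some ?w)"
    have w: "?w \<in> upper_half_plane" by (rule fricke_in_upper_half_plane[OF assms])
    have "fricke p x \<in> X0_involution p (Gamma0_class p (Some ?w))"
      using x by (auto simp: X0_involution_def)
    hence "fricke p x \<in> Gamma0_class p (Some \<tau>)" using sub[OF w] unfolding ww by blast
    moreover obtain y where y: "x = Some y" "y \<in> upper_half_plane"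
      using x moebius_in_upper_half_plane(2)[OF w]
      unfolding Gamma0_class_upper_half_plane[OF w] by blast
    hence "y \<noteq> 0" by (auto simp: upper_half_plane_def)
    hence "fricke p (fricke p x) = x" using y \<open>p > 0\<close> by (simp add: field_simps)
    ultimately show "x \<in> X0_involution p (Gamma0_class p (Some \<tau>))"
      unfolding X0_involution_def by (metis imageI)
  qed
  with sub[OF \<tau>] show ?thesis by blast
qed

lemma lifting_fricke:
  assumes "\<forall>x \<in> X0 p. F (X0_involution p x) = F x" "\<tau> \<in> upper_half_plane" "p > 0"
  shows "lifting p F (- 1 / (of_nat p * \<tau>)) = lifting p F \<tau>"
proof -
  have "Gamma0_class p (Some \<tau>) \<in> X0 p" using assms(2) by (auto simp: X0_def Hstar_def)
  thus ?thesis
    using assms(1) unfolding lifting_def X0_involution_class[OF assms(2,3), symmetric] by blast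
qed

text \<open>A point of the upper half plane is not equivalent to a cusp, so the polar divisor vanishes at its
  class.\<close>

lemma lifting_holomorphic:
  assumes mero: "lifting p F nicely_meromorphic_on upper_half_plane"
    and div: "has_polar_divisor p F
      (\<lambda>x. point_divisor (Gamma0_class p (Some 0)) x + point_divisor (Gamma0_class p None) x)"
  shows "lifting p F holomorphic_on upper_half_plane"
proof -
  have "\<not> is_pole (lifting p F) \<tau>" if \<tau>: "\<tau> \<in> upper_half_plane" for \<tau>
  proof
    assume pole: "is_pole (lifting p F) \<tau>"
    have "lifting p F meromorphic_on {\<tau>}"
      using mero \<tau> by (auto simp: nicely_meromorphic_on_def intro: meromorphic_on_subset)
    hence "isolated_singularity_at (lifting p F) \<tau>"
      by (rule meromorphic_on_isolated_singularity)
    hence "zorder (lifting p F) \<tau> < 0" using pole by (rule isolated_pole_imp_neg_zorder)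
    hence "pole_order (lifting p F) \<tau> \<noteq> 0" using pole by (simp add: pole_order_def)
    hence "point_divisor (Gamma0_class p (Some 0)) (Gamma0_class p (Some \<tau>)) +
       point_divisor (Gamma0_class p None) (Gamma0_class p (Some \<tau>)) \<noteq> 0"
      using div \<tau> unfolding has_polar_divisor_def by (metis mult_0_right)
    hence "Gamma0_class p (Some \<tau>) = Gamma0_class p (Some 0) \<or>
           Gamma0_class p (Some \<tau>) = Gamma0_class p None"
      by (auto simp: point_divisor_def split: if_splits)
    moreover have "x \<in> Gamma0_class p x" for x
    proof -
      have "mat 1 \<in> Gamma0 p" by (simp add: Gamma0_def SL2Z_def mat_def det_2)
      moreover have "moebius (mat 1) x = x" by (cases x) (simp_all add: mat_def)
      ultimately show ?thesis unfolding Gamma0_class_def by force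
    qed
    ultimately have "Some 0 \<in> Gamma0_class p (Some \<tau>) \<or> None \<in> Gamma0_class p (Some \<tau>)" by metis
    moreover have "x \<in> Some ` upper_half_plane" if "x \<in> Gamma0_class p (Some \<tau>)" for x
      using that moebius_in_upper_half_plane(2)[OF \<tau>]
      unfolding Gamma0_class_upper_half_plane[OF \<tau>] by blast
    ultimately show False by (force simp: upper_half_plane_def)
  qed
  hence "lifting p F analytic_on {\<tau>}" if "\<tau> \<in> upper_half_plane" for \<tau>
    using nicely_meromorphic_on_imp_analytic_at[OF mero that] that by blast
  hence "lifting p F analytic_on upper_half_plane" using analytic_on_analytic_at by blast
  thus ?thesis by (rule analytic_imp_holomorphic)
qed


section \<open>The trace to level one\<close>

lemma trace_point_in_upper_half_plane:
  assumes "\<tau> \<in> upper_half_plane" "p > 0"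
  shows "(\<tau> + of_nat m) / of_nat p \<in> upper_half_plane"
  using assms by (simp add: upper_half_plane_def Im_divide_of_nat)

lemma trace_holomorphic:
  assumes "lifting p F holomorphic_on upper_half_plane" "p > 0"
  shows "trace_function p F holomorphic_on upper_half_plane"
proof -
  have "(\<lambda>\<tau>. lifting p F ((\<tau> + of_nat m) / of_nat p)) holomorphic_on upper_half_plane" for m
    by (rule holomorphic_on_compose_gen[OF _ assms(1), unfolded o_def])
       (use trace_point_in_upper_half_plane assms(2) in \<open>auto intro!: holomorphic_intros\<close>)
  thus ?thesis unfolding trace_function_def [abs_def] using assms by (intro holomorphic_intros)
qed

lemma trace_translate:
  assumes "\<tau> \<in> upper_half_plane" "p > 0"
  shows "trace_function p F (\<tau> + 1) = trace_function p F \<tau>"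
proof -
  have T: "lifting p F (\<sigma> + 1) = lifting p F \<sigma>" if "\<sigma> \<in> upper_half_plane" for \<sigma>
    using lifting_moebius[OF that, of 1 1 1 0 p F] by simp
  let ?h = "\<lambda>m. lifting p F ((\<tau> + of_nat m) / of_nat p)"
  have "(\<Sum>m<p. lifting p F ((\<tau> + 1 + of_nat m) / of_nat p)) = (\<Sum>m<p. ?h (Suc m))"
    by (simp add: add_ac)
  also have "\<dots> = (\<Sum>m<p. ?h m) + ?h p - ?h 0"
    using sum.lessThan_Suc_shift[of ?h p] by simp
  also have "?h p = ?h 0"
    using T[OF trace_point_in_upper_half_plane[OF assms, of 0]] assms(2)
    by (simp add: add_divide_distrib)
  finally show ?thesis using T[OF assms(1)] by (simp add: trace_function_def)
qed

text \<open>With \<open>m m' + 1 = p k\<close>, the points \<open>(-1/\<tau> + m)/p\<close> and \<open>(\<tau> + m')/p\<close> are related by the matrix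
  with rows \<open>(m, -k)\<close> and \<open>(p, -m')\<close>, whose determinant is \<open>p k - m m' = 1\<close>.\<close>

lemma lifting_inversion_swap:
  assumes \<tau>: "\<tau> \<in> upper_half_plane" and "p > 0" and dvd: "int p dvd int m * int m' + 1"
  shows "lifting p F ((- 1 / \<tau> + of_nat m) / of_nat p) = lifting p F ((\<tau> + of_nat m') / of_nat p)"
proof -
  from dvd obtain k where k: "int m * int m' + 1 = int p * k" by auto
  let ?\<sigma> = "(\<tau> + of_nat m') / of_nat p"
  have \<tau>0: "\<tau> \<noteq> 0" using \<tau> by (auto simp: upper_half_plane_def)
  have kc: "of_nat m * of_nat m' + 1 = (of_nat p * of_int k :: complex)"
    using arg_cong[OF k, of of_int] by simp
  have "of_int (int m) * ?\<sigma> + of_int (- k) =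
      (of_nat m * \<tau> + (of_nat m * of_nat m' + 1) - 1 - of_nat p * of_int k) / of_nat p"
    using \<open>p > 0\<close> by (simp add: field_simps)
  also have "\<dots> = (of_nat m * \<tau> - 1) / of_nat p" unfolding kc by simp
  finally have num: "of_int (int m) * ?\<sigma> + of_int (- k) = (of_nat m * \<tau> - 1) / of_nat p" .
  have den: "of_int (int p) * ?\<sigma> + of_int (- int m') = \<tau>"
    using \<open>p > 0\<close> by simp
  have "(- 1 / \<tau> + of_nat m) / of_nat p =
    (of_int (int m) * ?\<sigma> + of_int (- k)) / (of_int (int p) * ?\<sigma> + of_int (- int m'))"
    unfolding num den using \<tau>0 \<open>p > 0\<close> by (simp add: field_simps)
  thus ?thesis
    using lifting_moebius[OF trace_point_in_upper_half_plane[OF \<tau> \<open>p > 0\<close>, of m'],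
        where a = "int m" and b = "- k" and c = "int p" and d = "- int m'" and p = p and F = F] k
    by (simp add: algebra_simps)
qed

lemma prime_negative_inverse_bij:
  assumes "prime p"
  obtains s where "bij_betw s {1..<p} {1..<p}"
    "\<And>m. m \<in> {1..<p} \<Longrightarrow> int p dvd int m * int (s m) + 1"
proof -
  have ex: "\<exists>m'. m' \<in> {1..<p} \<and> int p dvd int m * int m' + 1" if m: "m \<in> {1..<p}" for m
  proof -
    have "coprime p m"
      using m assms by (auto intro!: prime_imp_coprime dest: dvd_imp_le)
    hence "gcd (int m) (int p) = 1" by (simp add: coprime_commute)
    then obtain u v where uv: "u * int m + v * int p = 1"
      using bezout_int[of "int m" "int p"] by auto
    define m' where "m' = nat ((- u) mod int p)"
    have p: "p > 1" using assms by (rule prime_gt_1_nat)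
    have m': "int m' = (- u) mod int p" "m' < p"
      using p by (auto simp: m'_def nat_less_iff)
    have "u * int m + int m * int m' = - int m * (int p * ((- u) div int p))"
    proof -
      have "u + int m' = - (int p * ((- u) div int p))"
        unfolding m' by (simp add: minus_mult_div_eq_mod [symmetric])
      thus ?thesis by (metis distrib_left minus_mult_commute mult.commute)
    qed
    hence "int m * int m' + 1 = int p * (v - int m * ((- u) div int p))"
      using uv by (simp add: algebra_simps)
    hence dvd: "int p dvd int m * int m' + 1" by simp
    moreover have "m' \<noteq> 0"
    proof
      assume "m' = 0"
      with dvd have "int p dvd 1" by simp
      thus False using p by simp
    qed
    ultimately show ?thesis using m'(2) by (intro exI[of _ m']) auto
  qed
  define s where "s m = (SOME m'. m' \<in> {1..<p} \<and> int p dvd int m * int m' + 1)" for m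
  have s: "s m \<in> {1..<p}" "int p dvd int m * int (s m) + 1" if "m \<in> {1..<p}" for m
    using someI_ex[OF ex[OF that]] by (auto simp: s_def)
  have unique: "m = m'" if "m \<in> {1..<p}" "m' \<in> {1..<p}" "int p dvd int m * k + 1"
    "int p dvd int m' * k + 1" for m m' k
  proof -
    have "int p dvd (int m * k + 1) - (int m' * k + 1)" using that by (intro dvd_diff)
    hence "int p dvd (int m - int m') * k" by (simp add: algebra_simps)
    moreover have "\<not> int p dvd k"
    proof
      assume "int p dvd k"
      hence "int p dvd (int m * k + 1) - int m * k" using that(3) by (intro dvd_diff) auto
      thus False using prime_gt_1_nat[OF assms] by simp
    qed
    ultimately have "int p dvd int m - int m'"
      using assms by (simp add: prime_dvd_mult_iff)
    moreover have "\<bar>int m - int m'\<bar> < int p" using that by auto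
    ultimately show ?thesis using dvd_imp_le_int[of "int m - int m'" "int p"] by fastforce
  qed
  have "inj_on s {1..<p}"
    using s unique by (intro inj_onI) metis
  moreover have "s ` {1..<p} \<subseteq> {1..<p}" using s by blast
  ultimately have "bij_betw s {1..<p} {1..<p}"
    by (simp add: bij_betw_def endo_inj_surj)
  with s show ?thesis using that by blast
qed

text \<open>Under \<open>\<tau> \<mapsto> -1/\<tau>\<close> the summand \<open>F \<tau>\<close> and the summand for \<open>m = 0\<close> are exchanged, by the invariance
  under \<open>\<tau> \<mapsto> -1/(p\<tau>)\<close>; the other summands are permuted by \<open>m \<mapsto> -1/m\<close> modulo \<open>p\<close>.\<close>

lemma trace_inversion:
  assumes inv: "\<forall>x \<in> X0 p. F (X0_involution p x) = F x"
    and \<tau>: "\<tau> \<in> upper_half_plane" and "prime p"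
  shows "trace_function p F (- 1 / \<tau>) = trace_function p F \<tau>"
proof -
  have p: "p > 0" using \<open>prime p\<close> by (rule prime_gt_0_nat)
  have split: "trace_function p F \<sigma> = lifting p F \<sigma> + lifting p F (\<sigma> / of_nat p) +
      (\<Sum>m\<in>{1..<p}. lifting p F ((\<sigma> + of_nat m) / of_nat p))" for \<sigma>
    using p by (simp add: trace_function_def sum.atLeast_Suc_lessThan lessThan_atLeast0)
  obtain s where s: "bij_betw s {1..<p} {1..<p}"
    "\<And>m. m \<in> {1..<p} \<Longrightarrow> int p dvd int m * int (s m) + 1"
    using prime_negative_inverse_bij[OF \<open>prime p\<close>] by blast
  have \<tau>p: "\<tau> / of_nat p \<in> upper_half_plane"
    using trace_point_in_upper_half_plane[OF \<tau> p, of 0] by simp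
  have 1: "lifting p F (- 1 / \<tau>) = lifting p F (\<tau> / of_nat p)"
    using lifting_fricke[OF inv \<tau>p p] p by simp
  have 2: "lifting p F (- 1 / \<tau> / of_nat p) = lifting p F \<tau>"
    using lifting_fricke[OF inv \<tau> p] by (simp add: mult.commute)
  have "(\<Sum>m\<in>{1..<p}. lifting p F ((- 1 / \<tau> + of_nat m) / of_nat p)) =
     (\<Sum>m\<in>{1..<p}. lifting p F ((\<tau> + of_nat (s m)) / of_nat p))"
    using s(2) by (intro sum.cong refl lifting_inversion_swap[OF \<tau> p]) auto
  also have "\<dots> = (\<Sum>m\<in>{1..<p}. lifting p F ((\<tau> + of_nat m) / of_nat p))"
    by (rule sum.reindex_bij_betw[OF s(1)])
  finally show ?thesis unfolding split 1 2 by simp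
qed

lemma sum_nome_roots_of_unity:
  assumes "p > 0"
  shows "(\<Sum>m<p. nome (of_int n * of_nat m / of_nat p)) = (if int p dvd n then of_nat p else 0)"
proof -
  let ?w = "nome (of_int n / of_nat p)"
  have pow: "nome (of_int n * of_nat m / of_nat p) = ?w ^ m" for m
    unfolding nome_power by (simp add: mult_ac)
  show ?thesis
  proof (cases "int p dvd n")
    case True
    then obtain k where "n = int p * k" by auto
    hence "?w = 1" using assms by simp
    thus ?thesis using True unfolding pow by simp
  next
    case False
    have "?w \<noteq> 1"
    proof
      assume "?w = 1"
      hence "?w = nome 0" using nome_of_nat[of 0] by simp
      then obtain k :: int where "of_int n / of_nat p = 0 + (of_int k :: complex)"
        by (rule nome_eq_imp_translate)
      hence "of_int n = (of_int (k * int p) :: complex)" using assms by (simp add: field_simps)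
      hence "n = k * int p" by (simp only: of_int_eq_iff)
      thus False using False by simp
    qed
    moreover have "?w ^ p = 1" using assms by (simp add: nome_power)
    ultimately show ?thesis using False unfolding pow by (simp add: sum_gp_strict)
  qed
qed

text \<open>The polar terms of the summands at \<open>(\<tau> + m)/p\<close> add up to \<open>q\<^bsup>-1/p\<^esup>\<close> times the sum of all \<open>p\<close>-th roots
  of unity, which is zero for \<open>p > 1\<close>. So only \<open>F \<tau>\<close> itself contributes a pole.\<close>

lemma trace_expansion:
  assumes exp: "\<And>\<tau>. Im \<tau> > Y \<Longrightarrow>
      (\<lambda>n. \<alpha> n * nome \<tau> ^ n) sums (lifting p F \<tau> - inverse (nome \<tau>))"
    and Y: "Y > 0" and p: "p > 1" and \<tau>: "Im \<tau> > of_nat p * Y"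
  shows "(\<lambda>n. (\<alpha> n + of_nat p * \<alpha> (n * p)) * nome \<tau> ^ n) sums
      (trace_function p F \<tau> - inverse (nome \<tau>))"
proof -
  let ?\<sigma> = "\<lambda>m. (\<tau> + of_nat m) / of_nat p" and ?r = "nome (\<tau> / of_nat p)"
  have nome\<sigma>: "nome (?\<sigma> m) = ?r * nome (of_nat m / of_nat p)" for m
    by (simp add: add_divide_distrib nome_add)
  have pow: "nome (?\<sigma> m) ^ n = ?r ^ n * nome (of_int (int n) * of_nat m / of_nat p)" for m n
    unfolding nome\<sigma> power_mult_distrib nome_power[of "of_nat m / of_nat p"] by simp
  have inv: "inverse (nome (?\<sigma> m)) = inverse ?r * nome (of_int (- 1) * of_nat m / of_nat p)" for m
  proof -
    have "nome (of_nat m / of_nat p) * nome (of_int (- 1) * of_nat m / of_nat p) = 1"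
      unfolding nome_add[symmetric] using nome_of_nat[of 0] by simp
    thus ?thesis unfolding nome\<sigma> by (simp add: field_simps)
  qed
  have "Im (?\<sigma> m) > Y" for m
    using \<tau> p by (simp add: Im_divide_of_nat pos_less_divide_eq mult.commute)
  hence "(\<lambda>n. \<Sum>m<p. \<alpha> n * nome (?\<sigma> m) ^ n) sums
      (\<Sum>m<p. lifting p F (?\<sigma> m) - inverse (nome (?\<sigma> m)))"
    by (intro sums_sum exp)
  also have "(\<lambda>n. \<Sum>m<p. \<alpha> n * nome (?\<sigma> m) ^ n) =
      (\<lambda>n. if p dvd n then of_nat p * \<alpha> n * ?r ^ n else 0)"
  proof
    fix n
    have "(\<Sum>m<p. \<alpha> n * nome (?\<sigma> m) ^ n) =
       \<alpha> n * ?r ^ n * (\<Sum>m<p. nome (of_int (int n) * of_nat m / of_nat p))"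
      unfolding pow sum_distrib_left by (simp add: mult_ac)
    also have "\<dots> = (if p dvd n then of_nat p * \<alpha> n * ?r ^ n else 0)"
      using p by (subst sum_nome_roots_of_unity) auto
    finally show "(\<Sum>m<p. \<alpha> n * nome (?\<sigma> m) ^ n) = \<dots>" .
  qed
  also have "(\<Sum>m<p. lifting p F (?\<sigma> m) - inverse (nome (?\<sigma> m))) =
      (\<Sum>m<p. lifting p F (?\<sigma> m))"
    unfolding sum_subtractf inv sum_distrib_left[symmetric]
    by (subst sum_nome_roots_of_unity) (use p in auto)
  finally have "(\<lambda>n. if p dvd n then of_nat p * \<alpha> n * ?r ^ n else 0) sums
      (\<Sum>m<p. lifting p F (?\<sigma> m))" .
  hence "(\<lambda>k. if p dvd k * p then of_nat p * \<alpha> (k * p) * ?r ^ (k * p) else 0) sums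
      (\<Sum>m<p. lifting p F (?\<sigma> m))"
    by (subst sums_mono_reindex[where g = "\<lambda>k. k * p"])
       (use p in \<open>auto simp: strict_mono_def elim!: dvdE\<close>)
  moreover have "?r ^ (k * p) = nome \<tau> ^ k" for k
    using p by (simp add: mult.commute[of k] power_mult nome_power[of _ p])
  ultimately have "(\<lambda>k. of_nat p * \<alpha> (k * p) * nome \<tau> ^ k) sums (\<Sum>m<p. lifting p F (?\<sigma> m))"
    by simp
  moreover have "Y \<le> of_nat p * Y" using p Y by simp
  hence "(\<lambda>n. \<alpha> n * nome \<tau> ^ n) sums (lifting p F \<tau> - inverse (nome \<tau>))"
    using \<tau> by (intro exp) linarith
  ultimately have "(\<lambda>n. \<alpha> n * nome \<tau> ^ n + of_nat p * \<alpha> (n * p) * nome \<tau> ^ n) sums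
     (lifting p F \<tau> - inverse (nome \<tau>) + (\<Sum>m<p. lifting p F (?\<sigma> m)))"
    by (intro sums_add)
  thus ?thesis by (simp add: trace_function_def algebra_simps)
qed


section \<open>Comparison with the modular invariant\<close>

theorem mainTheorem6:
  fixes p :: nat
    and G :: "complex option set \<Rightarrow> complex"
    and \<alpha> c :: "nat \<Rightarrow> complex"
  assumes "p \<in> {2, 3, 5, 7, 11, 13, 17, 19, 23, 29, 31, 41, 47, 59, 71}"
    and "X0_meromorphic p G"
    and "has_degree p G 2"
    and "\<forall>x \<in> X0 p. G (X0_involution p x) = G x"
    and "has_polar_divisor p G
           (\<lambda>x. point_divisor (Gamma0_class p (Some 0)) x + point_divisor (Gamma0_class p None) x)"
    and "\<exists>Y>0. \<forall>\<tau>. Im \<tau> > Y \<longrightarrow>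
           (\<lambda>n. \<alpha> n * nome \<tau> ^ n) sums (lifting p G \<tau> - inverse (nome \<tau>))"
    and "\<forall>\<tau> \<in> upper_half_plane.
           (\<lambda>n. c (Suc n) * nome \<tau> ^ Suc n) sums (modular_j \<tau> - inverse (nome \<tau>) - 744)"
  shows "744 = \<alpha> 0 * (of_nat p + 1) - trace_function p G rho
       \<and> (\<forall>n\<ge>1. c n = \<alpha> n + of_nat p * \<alpha> (n * p))"
proof -
  have prime: "prime p" using assms(1) by auto
  note p = prime_gt_0_nat[OF prime] prime_gt_1_nat[OF prime]
  obtain Y where Y: "Y > 0" "\<And>\<tau>. Im \<tau> > Y \<Longrightarrow>
      (\<lambda>n. \<alpha> n * nome \<tau> ^ n) sums (lifting p G \<tau> - inverse (nome \<tau>))"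
    using assms(6) by blast
  \<comment> \<open>The sequence \<open>c\<close> describes \<open>j\<close> only from index 1 on; \<open>e\<close> adds the constant term.\<close>
  define e where "e = c(0 := 744)"
  have j_exp: "(\<lambda>n. e n * nome \<tau> ^ n) sums (modular_j \<tau> - inverse (nome \<tau>))"
    if "\<tau> \<in> upper_half_plane" for \<tau>
    using assms(7) that
      sums_Suc_iff[of "\<lambda>n. e n * nome \<tau> ^ n" "modular_j \<tau> - inverse (nome \<tau>) - 744"]
    by (simp add: e_def)
  define D where "D \<tau> = trace_function p G \<tau> - modular_j \<tau>" for \<tau>
  define b where "b n = \<alpha> n + of_nat p * \<alpha> (n * p) - e n" for n
  have "lifting p G holomorphic_on upper_half_plane"
    using assms(2,5) by (intro lifting_holomorphic) (auto simp: X0_meromorphic_def)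
  hence hol: "D holomorphic_on upper_half_plane"
    unfolding D_def using p
    by (intro holomorphic_on_diff trace_holomorphic modular_j_holomorphic[OF j_exp])
  have per: "D (\<tau> + 1) = D \<tau>" if "\<tau> \<in> upper_half_plane" for \<tau>
    using trace_translate[OF that p(1)] modular_j_moebius[of 1 1 1 0 \<tau>] by (simp add: D_def)
  have inv: "D (- 1 / \<tau>) = D \<tau>" if "\<tau> \<in> upper_half_plane" for \<tau>
  proof -
    have "\<tau> \<noteq> 0" using that by (auto simp: upper_half_plane_def)
    thus ?thesis
      using trace_inversion[OF assms(4) that prime] modular_j_moebius[of 0 0 "-1" 1 \<tau>]
      by (simp add: D_def)
  qed
  have exp: "(\<lambda>n. b n * nome \<tau> ^ n) sums D \<tau>" if "Im \<tau> > of_nat p * Y" for \<tau>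
  proof -
    have "of_nat p * Y > 0" using p Y(1) by simp
    hence "\<tau> \<in> upper_half_plane" using that unfolding upper_half_plane_def by simp
    from sums_diff[OF trace_expansion[OF Y(2) Y(1) p(2) that] j_exp[OF this]]
    show ?thesis by (simp add: b_def D_def algebra_simps)
  qed
  have "of_nat p * Y > 0" using p Y(1) by simp
  note const = holomorphic_modular_function_constant[OF hol per inv exp this]
  have "D rho = b 0" using const(1) rho_in_upper_half_plane by blast
  hence "744 = \<alpha> 0 * (of_nat p + 1) - trace_function p G rho"
    by (simp add: D_def b_def e_def modular_j_rho algebra_simps)
  moreover have "c n = \<alpha> n + of_nat p * \<alpha> (n * p)" if "n \<ge> 1" for n
    proof -
    have "b n = 0" using const(2) that by blast
    thus ?thesis using that by (simp add: b_def e_def)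
  qed
  ultimately show ?thesis by blast
qed

end
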